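(* Let $n\ge 1$. Each of the following statistics on $S_n$ is $\frac{n+1}{2}$-mesic for permutations with rotation (i.e. its average over every orbit of $rot$ on $S_n$ equals $\frac{n+1}{2}$): (1) the first entry $\pi(1)$; (2) the last entry $\pi(n)$; (3) the upper middle entry $\pi\left(\lceil\frac{n+1}{2}\rceil\right)$; (4) the lower middle entry $\pi\left(\lfloor\frac{n+1}{2}\rfloor\right)$.
   Context: $[n]=\{1,\dots,n\}$ and $S_n$ is the set of permutations of $[n]$, written in one-line notation $\pi=\pi(1)\pi(2)\cdots\pi(n)$. The rotation map $rot:S_n\to S_n$ sends $\pi(1)\pi(2)\cdots\pi(n)$ to $\pi(2)\cdots\pi(n)\pi(1)$. For a bijection $\varphi:S_n\to S_n$, the orbits are the sets $\mathcal{O}_\pi=\{\varphi^m(\pi)\}$ of permutations obtained by applying $\varphi$ any number of times. A statistic $st$ is $c$-mesic for $\varphi$ if $\frac{1}{\#\mathcal{O}}\sum_{x\in\mathcal{O}}st(x)=c$ for every orbit $\mathcal{O}$. *)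

theory Defs
  imports Complex_Main "HOL-Combinatorics.Permutations"
begin

text \<open>Elements of \<open>S\<^sub>n\<close> are functions on \<^typ>\<open>nat\<close> that permute \<open>{1..n}\<close> and, by the library's
  convention, fix every other number; thus \<open>p i\<close> is the \<open>i\<close>-th entry in one-line notation.\<close>

definition Sym :: "nat \<Rightarrow> (nat \<Rightarrow> nat) set" where
  "Sym n = {p. p permutes {1..n}}"

definition rot :: "nat \<Rightarrow> (nat \<Rightarrow> nat) \<Rightarrow> (nat \<Rightarrow> nat)" where
  "rot n p = (\<lambda>i. if 1 \<le> i \<and> i < n then p (i + 1) else if i = n then p 1 else i)"

lemma rot_one_line:
  assumes "n \<ge> 1"
  shows "map (rot n p) [1..<n+1] = rotate1 (map p [1..<n+1])"
  using assms
  by (intro nth_equalityI) (auto simp: rot_def nth_rotate1 mod_Suc simp del: upt_Suc)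

text \<open>The library's \<open>orbit\<close> only collects the iterates with a positive exponent; here the exponent
  \<open>0\<close> is included.\<close>

definition orb :: "('a \<Rightarrow> 'a) \<Rightarrow> 'a \<Rightarrow> 'a set" where
  "orb \<phi> x = {(\<phi> ^^ m) x | m. True}"

text \<open>Mesicity is only defined for bijections of \<open>S\<^sub>n\<close>, hence the first conjunct. All orbits are
  then finite and nonempty, so that the quotient is a genuine average.\<close>

definition mesic :: "nat \<Rightarrow> ((nat \<Rightarrow> nat) \<Rightarrow> (nat \<Rightarrow> nat)) \<Rightarrow> ((nat \<Rightarrow> nat) \<Rightarrow> real) \<Rightarrow> real \<Rightarrow> bool" where
  "mesic n \<phi> st c \<longleftrightarrow>
     bij_betw \<phi> (Sym n) (Sym n) \<and>
     (\<forall>\<O> \<in> orb \<phi> ` Sym n. (1 / real (card \<O>)) * (\<Sum>x\<in>\<O>. st x) = c)"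

end

theory Submission
  imports Defs "HOL-Number_Theory.Cong"
begin

text \<open>All four statistics read off the entry at a fixed position \<open>i \<in> {1..n}\<close>, and every
  such statistic is mesic (\<open>mesic_entry\<close>). Rotating \<open>m\<close> times moves the entry at the position
  \<open>m\<close> places further on, counted cyclically, to position \<open>i\<close> (\<open>funpow_rot_entry\<close>). The entries
  of a permutation are distinct, so the first \<open>n\<close> rotations are pairwise different, while the
  \<open>n\<close>-th one is the identity: every orbit has exactly \<open>n\<close> elements
  (\<open>inj_on_funpow_rot\<close>, \<open>orb_rot\<close>). Along an orbit, the fixed position \<open>i\<close> therefore shows each
  entry of the permutation exactly once, and the average is that of \<open>1, \<dots>, n\<close>, namely
  \<open>(n + 1) / 2\<close>.\<close>

text \<open>Counting positions from \<open>0\<close>, as in \<open>Suc j\<close>, turns the wrap-around into a plain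
  \<open>mod\<close>.\<close>

lemma rot_entry:
  assumes "j < n"
  shows "rot n p (Suc j) = p (Suc (Suc j mod n))"
  using assms by (auto simp: rot_def mod_Suc)

lemma funpow_rot_entry:
  assumes "j < n"
  shows "(rot n ^^ m) p (Suc j) = p (Suc ((j + m) mod n))"
  using assms
proof (induction m arbitrary: j)
  case 0
  then show ?case by simp
next
  case (Suc m)
  have "(rot n ^^ Suc m) p (Suc j) = (rot n ^^ m) p (Suc (Suc j mod n))"
    using Suc.prems by (simp add: rot_entry)
  also have "\<dots> = p (Suc ((Suc j mod n + m) mod n))"
    using Suc.prems by (intro Suc.IH) simp
  also have "(Suc j mod n + m) mod n = (j + Suc m) mod n"
    by (simp add: mod_add_left_eq)
  finally show ?case .
qed

lemma bij_betw_cyclic_shift: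
  assumes "n \<ge> 1"
  shows "bij_betw (\<lambda>m. Suc ((j + m) mod n)) {..<n} {1..n}"
proof -
  have inj: "inj_on (\<lambda>m. Suc ((j + m) mod n)) {..<n}"
  proof (rule inj_onI)
    fix a b assume ab: "a \<in> {..<n}" "b \<in> {..<n}"
      and "Suc ((j + a) mod n) = Suc ((j + b) mod n)"
    then have "[j + a = j + b] (mod n)"
      by (simp add: cong_def)
    then have "[a = b] (mod n)"
      by (simp add: cong_add_lcancel_nat)
    then show "a = b"
      using ab by (simp add: cong_def)
  qed
  moreover have "(\<lambda>m. Suc ((j + m) mod n)) ` {..<n} \<subseteq> {1..n}"
    using assms by (auto simp: Suc_le_eq)
  ultimately show ?thesis
    by (simp add: bij_betw_def card_image card_subset_eq)
qed

text \<open>A rotation is precomposition with the cyclic shift of the positions, which is the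
  rotation of the identity permutation.\<close>

lemma rot_eq_comp:
  assumes "p \<in> Sym n"
  shows "rot n p = p \<circ> rot n id"
proof
  fix i
  have "p i = i" if "i \<notin> {1..n}"
    using assms that by (simp add: Sym_def permutes_not_in)
  then show "rot n p i = (p \<circ> rot n id) i"
    by (auto simp: rot_def)
qed

lemma rot_id_permutes:
  assumes "n \<ge> 1"
  shows "rot n id permutes {1..n}"
proof (rule inj_imp_permutes)
  show "inj_on (rot n id) {1..n}"
    by (auto simp: inj_on_def rot_def split: if_splits)
qed (use assms in \<open>auto simp: rot_def\<close>)

lemma rot_in_Sym:
  assumes "n \<ge> 1" "p \<in> Sym n"
  shows "rot n p \<in> Sym n"
  using assms rot_id_permutes[OF assms(1)]
  by (simp only: rot_eq_comp[OF assms(2)]) (simp add: Sym_def permutes_compose)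

lemma funpow_rot_in_Sym:
  assumes "n \<ge> 1" "p \<in> Sym n"
  shows "(rot n ^^ m) p \<in> Sym n"
  using assms by (induction m) (simp_all add: rot_in_Sym)

lemma bij_betw_rot:
  assumes "n \<ge> 1"
  shows "bij_betw (rot n) (Sym n) (Sym n)"
proof -
  have "inj_on (rot n) (Sym n)"
  proof (rule inj_onI)
    fix p q assume "p \<in> Sym n" "q \<in> Sym n" "rot n p = rot n q"
    then have "p \<circ> rot n id = q \<circ> rot n id"
      by (simp only: rot_eq_comp)
    moreover have "surj (rot n id)"
      by (rule permutes_surj[OF rot_id_permutes[OF assms]])
    ultimately show "p = q"
      by (metis surj_fun_eq UNIV_I fun_eq_iff comp_apply surj_def)
  qed
  moreover have "finite (Sym n)"
    by (simp add: Sym_def finite_permutations)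
  moreover have "rot n ` Sym n \<subseteq> Sym n"
    using assms by (auto intro: rot_in_Sym)
  ultimately show ?thesis
    by (simp add: bij_betw_def endo_inj_surj)
qed

lemma funpow_rot_mod:
  assumes "n \<ge> 1" "p \<in> Sym n"
  shows "(rot n ^^ m) p = (rot n ^^ (m mod n)) p"
proof
  fix i
  show "(rot n ^^ m) p i = (rot n ^^ (m mod n)) p i"
  proof (cases "i \<in> {1..n}")
    case True
    then obtain j where "i = Suc j" "j < n"
      by (cases i) auto
    then show ?thesis
      by (simp add: funpow_rot_entry mod_add_right_eq)
  next
    case False
    then show ?thesis
      using funpow_rot_in_Sym[OF assms] by (metis (no_types) Sym_def mem_Collect_eq permutes_not_in)
  qed
qed

lemma orb_rot:
  assumes "n \<ge> 1" "p \<in> Sym n"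
  shows "orb (rot n) p = (\<lambda>m. (rot n ^^ m) p) ` {..<n}"
proof
  show "orb (rot n) p \<subseteq> (\<lambda>m. (rot n ^^ m) p) ` {..<n}"
  proof
    fix q assume "q \<in> orb (rot n) p"
    then obtain m where "q = (rot n ^^ m) p"
      by (auto simp: orb_def)
    then have "q = (rot n ^^ (m mod n)) p"
      using funpow_rot_mod[OF assms] by simp
    then show "q \<in> (\<lambda>m. (rot n ^^ m) p) ` {..<n}"
      using assms(1) by auto
  qed
qed (auto simp: orb_def)

lemma inj_on_funpow_rot:
  assumes "n \<ge> 1" "p \<in> Sym n"
  shows "inj_on (\<lambda>m. (rot n ^^ m) p) {..<n}"
proof (rule inj_onI)
  fix a b assume ab: "a \<in> {..<n}" "b \<in> {..<n}" and eq: "(rot n ^^ a) p = (rot n ^^ b) p"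
  \<comment> \<open>The first entry alone tells the rotations apart.\<close>
  have "p (Suc a) = p (Suc b)"
    using fun_cong[OF eq, of "Suc 0"] ab funpow_rot_entry[of 0 n _ p] assms(1) by simp
  moreover have "inj p"
    using assms(2) by (auto simp: Sym_def intro: permutes_inj)
  ultimately show "a = b"
    by (simp add: inj_eq)
qed

lemma sum_entries:
  assumes "p \<in> Sym n"
  shows "(\<Sum>i=1..n. real (p i)) = real n * (real n + 1) / 2"
proof -
  have "(\<Sum>i=1..n. real (p i)) = (\<Sum>i=1..n. real i)"
    using assms by (intro sum.reindex_bij_betw) (simp add: Sym_def permutes_imp_bij)
  also have "\<dots> = real n * (real n + 1) / 2"
    using double_gauss_sum_from_Suc_0[of n, where 'a = real] by simp
  finally show ?thesis .
qed

theorem mesic_entry: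
  assumes "i \<in> {1..n}"
  shows "mesic n (rot n) (\<lambda>p. real (p i)) ((real n + 1) / 2)"
proof -
  have n: "n \<ge> 1"
    using assms by simp
  obtain j where j: "i = Suc j" "j < n"
    using assms by (cases i) auto
  have "1 / real (card (orb (rot n) p)) * (\<Sum>q\<in>orb (rot n) p. real (q i)) = (real n + 1) / 2"
    if p: "p \<in> Sym n" for p
  proof -
    note inj = inj_on_funpow_rot[OF n p]
    have "card (orb (rot n) p) = n"
      by (simp add: orb_rot[OF n p] card_image[OF inj])
    moreover have "(\<Sum>q\<in>orb (rot n) p. real (q i)) = real n * (real n + 1) / 2"
    proof -
      have "(\<Sum>q\<in>orb (rot n) p. real (q i)) = (\<Sum>m<n. real ((rot n ^^ m) p i))"
        by (simp add: orb_rot[OF n p] sum.reindex[OF inj])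
      also have "\<dots> = (\<Sum>m<n. real (p (Suc ((j + m) mod n))))"
        using j by (simp add: funpow_rot_entry)
      also have "\<dots> = (\<Sum>k=1..n. real (p k))"
        by (rule sum.reindex_bij_betw[OF bij_betw_cyclic_shift[OF n]])
      finally show ?thesis
        by (simp only: sum_entries[OF p])
    qed
    ultimately show ?thesis
      using n by simp
  qed
  then show ?thesis
    using bij_betw_rot[OF n] by (auto simp: mesic_def)
qed

theorem corollary2p2:
  fixes n :: nat
  assumes "n \<ge> 1"
  shows "mesic n (rot n) (\<lambda>p. real (p 1)) ((real n + 1) / 2)
         \<and> mesic n (rot n) (\<lambda>p. real (p n)) ((real n + 1) / 2)
         \<and> mesic n (rot n) (\<lambda>p. real (p (nat \<lceil>(real n + 1) / 2\<rceil>))) ((real n + 1) / 2)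
         \<and> mesic n (rot n) (\<lambda>p. real (p (nat \<lfloor>(real n + 1) / 2\<rfloor>))) ((real n + 1) / 2)"
proof -
  have "nat \<lceil>(real n + 1) / 2\<rceil> \<in> {1..n}" "nat \<lfloor>(real n + 1) / 2\<rfloor> \<in> {1..n}"
    using assms by (simp_all add: le_nat_iff nat_le_iff le_floor_iff ceiling_le_iff floor_le_iff)
  then show ?thesis
    using assms by (intro conjI mesic_entry) simp_all
qed

end
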